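(* Let $I=(\mathcal{E},D,c,f)$ be a CMP instance whose objective $f$ is of type sum, product, or bottleneck, and let $E=\{e_1,\dots,e_k\}\subseteq\mathcal{E}$ be an arbitrary subset. Then: (a) $\bar l'_I(E)\le\min_{l=1}^k l'_I(e_l)$. (b) If $f$ is of type sum or product, then $\bar l'_I(E)=\min_{l=1}^k l'_I(e_l)$.
   Context: A combinatorial minimization problem (CMP) instance is $I=(\mathcal{E},D,c,f)$ where $\mathcal{E}$ is a finite ground set, $D\subseteq 2^{\mathcal{E}}\setminus\{\emptyset\}$ is a nonempty set of feasible solutions, $c:\mathcal{E}\to\mathbb{R}$ is a cost function, and $f:D\to\mathbb{R}$ is of one of three types: sum, $f(S)=\sum_{a\in S}c(a)$; product, $f(S)=\prod_{a\in S}c(a)$, where for this type all costs are positive; bottleneck, $f(S)=\max_{a\in S}c(a)$. $f(I)$ denotes the optimal (minimum) value of $f$ over $D$. For $E=\{e_1,\dots,e_k\}\subseteq\mathcal{E}$ and $\vec\alpha\in\mathbb{R}^k$, $I_{-\vec\alpha,E}$ is the instance with costs $c(e_l)-\alpha_l$ on $e_l$, other costs unchanged, and objective of the same type computed with these costs; $f_{-\vec\alpha,E}(I_{-\vec\alpha,E})$ is its optimal value. Let $\mathrm{maxdec}(e)=\infty$ if $f$ is of type sum or bottleneck and $\mathrm{maxdec}(e)=c(e)$ if of type product. Call $\vec\alpha$ admissible for $E$ if $0\le\alpha_l<\mathrm{maxdec}(e_l)$ for all $l$. New lower tolerances (values in $\mathbb{R}\cup\{\infty\}$, $\sup$ of an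 unbounded set and $\inf\emptyset$ being $\infty$): $l'_I(E)=\sup\{\alpha\mid\exists$ admissible $\vec\alpha$, $\sum_l\alpha_l=\alpha$, $f_{-\vec\alpha,E}(I_{-\vec\alpha,E})=f(I)\}$; reverse set lower tolerance $\bar l'_I(E)=\inf\{\alpha\mid\exists$ admissible $\vec\alpha$, $\sum_l\alpha_l=\alpha$, $f_{-\vec\alpha,E}(I_{-\vec\alpha,E})<f(I)\}$; and for a single element $e$, $l'_I(e)=l'_I(\{e\})$.
   Formalization: For type product it is additionally assumed that every element of E lies in some feasible solution; otherwise (a) fails, e.g. for ground set {0,1}, D={{0}}, all costs 1, E={1}, where the reverse tolerance is ∞ but l'(1)=1. *)

theory Defs
  imports "HOL-Library.Extended_Real"
begin

datatype objective_type = Sum_Objective | Product_Objective | Bottleneck_Objective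

text \<open>
  The objective function is determined by its type and the costs, so an instance records
  the type only.
\<close>

record 'a cmp =
  ground :: "'a set"
  feasible :: "'a set set"
  cost :: "'a \<Rightarrow> real"
  objective_type :: objective_type

definition cmp_instance :: "'a cmp \<Rightarrow> bool" where
  "cmp_instance I \<longleftrightarrow>
     finite (ground I) \<and>
     feasible I \<subseteq> Pow (ground I) - {{}} \<and>
     feasible I \<noteq> {} \<and>
     (objective_type I = Product_Objective \<longrightarrow> (\<forall>e\<in>ground I. 0 < cost I e))"

definition objective :: "'a cmp \<Rightarrow> 'a set \<Rightarrow> real" where
  "objective I S =
     (case objective_type I of
        Sum_Objective \<Rightarrow> \<Sum>a\<in>S. cost I a
      | Product_Objective \<Rightarrow> \<Prod>a\<in>S. cost I a
      | Bottleneck_Objective \<Rightarrow> Max (cost I ` S))"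

definition opt_value :: "'a cmp \<Rightarrow> real" where
  "opt_value I = Min (objective I ` feasible I)"

text \<open>
  A vector indexed by the elements of \<open>E\<close> is a function \<open>\<alpha>\<close> of which only the
  values on \<open>E\<close> matter.
\<close>

definition decrease_costs :: "'a cmp \<Rightarrow> ('a \<Rightarrow> real) \<Rightarrow> 'a set \<Rightarrow> 'a cmp" where
  "decrease_costs I \<alpha> E =
     I\<lparr>cost := (\<lambda>e. if e \<in> E then cost I e - \<alpha> e else cost I e)\<rparr>"

definition maxdec :: "'a cmp \<Rightarrow> 'a \<Rightarrow> ereal" where
  "maxdec I e =
     (case objective_type I of
        Sum_Objective \<Rightarrow> \<infinity>
      | Product_Objective \<Rightarrow> ereal (cost I e)
      | Bottleneck_Objective \<Rightarrow> \<infinity>)"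

definition admissible :: "'a cmp \<Rightarrow> 'a set \<Rightarrow> ('a \<Rightarrow> real) \<Rightarrow> bool" where
  "admissible I E \<alpha> \<longleftrightarrow> (\<forall>e\<in>E. 0 \<le> \<alpha> e \<and> ereal (\<alpha> e) < maxdec I e)"

definition set_lower_tolerance :: "'a cmp \<Rightarrow> 'a set \<Rightarrow> ereal" where
  "set_lower_tolerance I E =
     Sup {ereal a | a. \<exists>\<alpha>. admissible I E \<alpha> \<and> (\<Sum>e\<in>E. \<alpha> e) = a \<and>
            opt_value (decrease_costs I \<alpha> E) = opt_value I}"

definition reverse_set_lower_tolerance :: "'a cmp \<Rightarrow> 'a set \<Rightarrow> ereal" where
  "reverse_set_lower_tolerance I E =
     Inf {ereal a | a. \<exists>\<alpha>. admissible I E \<alpha> \<and> (\<Sum>e\<in>E. \<alpha> e) = a \<and>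
            opt_value (decrease_costs I \<alpha> E) < opt_value I}"

definition lower_tolerance :: "'a cmp \<Rightarrow> 'a \<Rightarrow> ereal" where
  "lower_tolerance I e = set_lower_tolerance I {e}"

text \<open>
  For the product type an element lying in no feasible solution has lower tolerance equal to
  its (finite) cost, although no admissible decrease of it changes the optimal value.  The
  following instance shows that the inequality between the reverse set lower tolerance and
  the element tolerances fails for such elements.
\<close>

lemma uncovered_product_element:
  defines "I \<equiv> \<lparr>ground = {0, 1 :: nat}, feasible = {{0}}, cost = (\<lambda>_. 1),
                objective_type = Product_Objective\<rparr>"
  shows "cmp_instance I"
    and "lower_tolerance I 1 = 1"
    and "reverse_set_lower_tolerance I {1} = \<infinity>"
proof -
  show "cmp_instance I"
    by (auto simp: I_def cmp_instance_def)
  have opt: "opt_value (decrease_costs I \<alpha> {1}) = opt_value I" for \<alpha>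
    by (simp add: I_def opt_value_def objective_def decrease_costs_def)
  have adm: "admissible I {1} \<alpha> \<longleftrightarrow> 0 \<le> \<alpha> 1 \<and> \<alpha> 1 < 1" for \<alpha>
    by (simp add: I_def admissible_def maxdec_def one_ereal_def)
  show "reverse_set_lower_tolerance I {1} = \<infinity>"
    by (simp only: reverse_set_lower_tolerance_def opt) (simp add: top_ereal_def)
  have "(\<exists>\<alpha>. admissible I {1} \<alpha> \<and> (\<Sum>e\<in>{1}. \<alpha> e) = a) \<longleftrightarrow> a \<in> {0..<1}" for a
    unfolding adm by (auto intro!: exI[of _ "\<lambda>_. a"])
  then have "lower_tolerance I 1 = Sup {ereal a | a. a \<in> {0..<1}}"
    by (simp only: lower_tolerance_def set_lower_tolerance_def opt simp_thms)
  also have "{ereal a | a. a \<in> {0..<1}} = ereal ` {0..<1}"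
    by blast
  also have "\<dots> = {0..<1 :: ereal}"
  proof (intro set_eqI iffI)
    fix x :: ereal
    assume "x \<in> {0..<1}"
    then show "x \<in> ereal ` {0..<1}"
      by (cases x) (auto simp: zero_ereal_def one_ereal_def)
  qed (auto simp: zero_ereal_def one_ereal_def)
  also have "Sup {0..<1 :: ereal} = 1"
    by (rule Sup_atLeastLessThan) simp
  finally show "lower_tolerance I 1 = 1" .
qed

end

theory Submission
  imports Defs
begin

text \<open>
  Decreasing costs never increases an objective value, so the optimal value drops exactly when
  some feasible solution gets below the old optimum.  A decrease of a single \<open>e \<in> E\<close> beyond its
  lower tolerance is, padded with zeros, a decrease on \<open>E\<close> that lowers the optimum; this gives (a).
  For the product type such a decrease has to stay below \<open>cost I e\<close>, and one exists because \<open>e\<close> lies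
  in a feasible solution, whose value tends to \<open>0\<close>.  For (b), let a decrease \<open>\<alpha>\<close> of total \<open>A\<close> bring
  the feasible solution \<open>S\<close> below the optimum.  Shifting the whole amount \<open>A\<close> to one element of
  \<open>S \<inter> E\<close> is at least as good for \<open>S\<close>: any element works for sums, and for products the cheapest
  one does, by the Weierstrass inequality \<open>\<Prod>(1 - x\<^sub>i) \<ge> 1 - \<Sum>x\<^sub>i\<close>.
\<close>

section \<open>Instances and optimal values under a decrease of costs\<close>

lemma decrease_costs_simps [simp]:
  "ground (decrease_costs I \<alpha> E) = ground I"
  "feasible (decrease_costs I \<alpha> E) = feasible I"
  "objective_type (decrease_costs I \<alpha> E) = objective_type I"
  "cost (decrease_costs I \<alpha> E) e = (if e \<in> E then cost I e - \<alpha> e else cost I e)"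
  by (simp_all add: decrease_costs_def)

lemma cmp_instance_finite_feasible:
  assumes "cmp_instance I"
  shows "finite (feasible I)"
  using assms unfolding cmp_instance_def
  by (meson Diff_subset finite_Pow_iff finite_subset subset_trans)

lemma cmp_instance_feasibleD:
  assumes "cmp_instance I" "S \<in> feasible I"
  shows "finite S" "S \<noteq> {}" "S \<subseteq> ground I"
proof -
  have "S \<in> Pow (ground I) - {{}}"
    using assms unfolding cmp_instance_def by blast
  then show "S \<noteq> {}" "S \<subseteq> ground I"
    by auto
  then show "finite S"
    using assms(1) finite_subset unfolding cmp_instance_def by blast
qed

lemma cmp_instance_cost_pos:
  assumes "cmp_instance I" "objective_type I = Product_Objective" "e \<in> ground I"
  shows "0 < cost I e"
  using assms by (simp add: cmp_instance_def)

lemma opt_value_le_objective: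
  assumes "cmp_instance I" "S \<in> feasible I"
  shows "opt_value I \<le> objective I S"
  using assms(2) cmp_instance_finite_feasible[OF assms(1)] by (simp add: opt_value_def)

lemma opt_value_attained:
  assumes "cmp_instance I"
  obtains S where "S \<in> feasible I" "objective I S = opt_value I"
proof -
  have "opt_value I \<in> objective I ` feasible I"
    unfolding opt_value_def
    using assms cmp_instance_finite_feasible[OF assms]
    by (intro Min_in) (auto simp: cmp_instance_def)
  then show thesis using that by auto
qed

text \<open>For products, the comparison goes factor by factor, which needs the smaller factors to
  be nonnegative; sums and maxima are monotone for any signs.\<close>

lemma objective_mono:
  assumes "objective_type J = objective_type I" "finite S" "S \<noteq> {}"
    and "\<And>a. a \<in> S \<Longrightarrow> cost J a \<le> cost I a"
    and "\<And>a. objective_type I = Product_Objective \<Longrightarrow> a \<in> S \<Longrightarrow> 0 \<le> cost J a"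
  shows "objective J S \<le> objective I S"
proof (cases "objective_type I")
  case Sum_Objective
  then show ?thesis using assms by (auto simp: objective_def intro: sum_mono)
next
  case Product_Objective
  then show ?thesis using assms by (auto simp: objective_def intro: prod_mono)
next
  case Bottleneck_Objective
  have "cost J a \<le> Max (cost I ` S)" if "a \<in> S" for a
    using assms(2) assms(4)[OF that] that
    by (meson Max_ge finite_imageI image_eqI order_trans)
  then show ?thesis using assms Bottleneck_Objective by (simp add: objective_def)
qed

text \<open>For the product type, admissibility keeps every decrease strictly below the cost, so the
  costs remain positive.\<close>

lemma cmp_instance_decrease_costs:
  assumes "cmp_instance I" "admissible I E \<alpha>"
  shows "cmp_instance (decrease_costs I \<alpha> E)"
  using assms by (auto simp: cmp_instance_def admissible_def maxdec_def)

lemma objective_decrease_costs_le: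
  assumes "cmp_instance I" "admissible I E \<alpha>" "S \<in> feasible I"
  shows "objective (decrease_costs I \<alpha> E) S \<le> objective I S"
proof (rule objective_mono)
  fix a
  assume "objective_type I = Product_Objective" "a \<in> S"
  then show "0 \<le> cost (decrease_costs I \<alpha> E) a"
    using cmp_instance_cost_pos[OF cmp_instance_decrease_costs[OF assms(1,2)], of a]
      cmp_instance_feasibleD(3)[OF assms(1,3)]
    by (simp add: subset_iff less_imp_le del: decrease_costs_simps(4))
qed (use assms cmp_instance_feasibleD[OF assms(1,3)] in \<open>auto simp: admissible_def\<close>)

lemma opt_value_decrease_costs_le:
  assumes "cmp_instance I" "admissible I E \<alpha>"
  shows "opt_value (decrease_costs I \<alpha> E) \<le> opt_value I"
proof -
  obtain S where S: "S \<in> feasible I" "objective I S = opt_value I"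
    using opt_value_attained[OF assms(1)] .
  have "opt_value (decrease_costs I \<alpha> E) \<le> objective (decrease_costs I \<alpha> E) S"
    using opt_value_le_objective[OF cmp_instance_decrease_costs[OF assms]] S by simp
  also have "\<dots> \<le> opt_value I"
    using objective_decrease_costs_le[OF assms] S by metis
  finally show ?thesis .
qed

lemma admissible_cong:
  assumes "\<And>e. e \<in> E \<Longrightarrow> \<alpha> e = \<beta> e"
  shows "admissible I E \<alpha> \<longleftrightarrow> admissible I E \<beta>"
  using assms by (simp add: admissible_def)

lemma decrease_costs_cong:
  assumes "\<And>e. e \<in> E \<Longrightarrow> \<alpha> e = \<beta> e"
  shows "decrease_costs I \<alpha> E = decrease_costs I \<beta> E"
proof -
  have "(\<lambda>e. if e \<in> E then cost I e - \<alpha> e else cost I e) =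
      (\<lambda>e. if e \<in> E then cost I e - \<beta> e else cost I e)"
    using assms by auto
  then show ?thesis by (simp add: decrease_costs_def)
qed

section \<open>The tolerance of a single element, with a vector on \<open>{e}\<close> given by one
  real \<open>t\<close>\<close>

lemma lower_tolerance_eq:
  "lower_tolerance I e = Sup {ereal t | t. admissible I {e} (\<lambda>_. t) \<and>
     opt_value (decrease_costs I (\<lambda>_. t) {e}) = opt_value I}"
proof -
  have "(\<exists>\<alpha>. admissible I {e} \<alpha> \<and> (\<Sum>e\<in>{e}. \<alpha> e) = t \<and>
          opt_value (decrease_costs I \<alpha> {e}) = opt_value I) \<longleftrightarrow>
        admissible I {e} (\<lambda>_. t) \<and> opt_value (decrease_costs I (\<lambda>_. t) {e}) = opt_value I"
    (is "?L \<longleftrightarrow> ?R") for t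
  proof
    assume ?L
    then obtain \<alpha> where \<alpha>: "admissible I {e} \<alpha>" "\<alpha> e = t"
      "opt_value (decrease_costs I \<alpha> {e}) = opt_value I" by auto
    then show ?R
      using admissible_cong[of "{e}" \<alpha> "\<lambda>_. t" I] decrease_costs_cong[of "{e}" \<alpha> "\<lambda>_. t" I] by simp
  next
    assume ?R
    then show ?L by (intro exI[of _ "\<lambda>_. t"]) simp
  qed
  then show ?thesis
    by (simp only: lower_tolerance_def set_lower_tolerance_def)
qed

lemma lower_tolerance_nonneg:
  assumes "cmp_instance I" "e \<in> ground I"
  shows "0 \<le> lower_tolerance I e"
proof -
  have "(\<lambda>x. if x = e then cost I x - 0 else cost I x) = cost I"
    by auto
  then have "decrease_costs I (\<lambda>_. 0) {e} = I"
    by (simp only: decrease_costs_def singleton_iff) simp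
  moreover have "admissible I {e} (\<lambda>_. 0)"
    using assms by (cases "objective_type I") (auto simp: admissible_def maxdec_def cmp_instance_def)
  ultimately show ?thesis
    unfolding lower_tolerance_eq by (intro Sup_upper) (auto intro!: exI[of _ 0])
qed

text \<open>A decrease beyond the supremum cannot preserve the optimum, and no admissible decrease
  raises it.\<close>

lemma opt_value_less_if_lower_tolerance_less:
  assumes "cmp_instance I" "admissible I {e} (\<lambda>_. t)" "lower_tolerance I e < ereal t"
  shows "opt_value (decrease_costs I (\<lambda>_. t) {e}) < opt_value I"
proof -
  have "opt_value (decrease_costs I (\<lambda>_. t) {e}) \<noteq> opt_value I"
  proof
    assume "opt_value (decrease_costs I (\<lambda>_. t) {e}) = opt_value I"
    then have "ereal t \<le> lower_tolerance I e"
      unfolding lower_tolerance_eq using assms(2) by (intro Sup_upper) auto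
    then show False using assms(3) by simp
  qed
  with opt_value_decrease_costs_le[OF assms(1,2)] show ?thesis by simp
qed

text \<open>One solution \<open>S\<close> serves as a witness for all \<open>t\<close> above
  \<open>A\<close>: being below the old optimum, it shows that no such \<open>t\<close> preserves
  the optimal value.\<close>

lemma lower_tolerance_leI:
  assumes "cmp_instance I" "S \<in> feasible I"
    and "\<And>t. A < t \<Longrightarrow> admissible I {e} (\<lambda>_. t) \<Longrightarrow>
           objective (decrease_costs I (\<lambda>_. t) {e}) S < opt_value I"
  shows "lower_tolerance I e \<le> ereal A"
  unfolding lower_tolerance_eq
proof (rule Sup_least, clarify)
  fix t
  assume t: "admissible I {e} (\<lambda>_. t)"
    and eq: "opt_value (decrease_costs I (\<lambda>_. t) {e}) = opt_value I"
  have "opt_value I \<le> objective (decrease_costs I (\<lambda>_. t) {e}) S"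
    using opt_value_le_objective[OF cmp_instance_decrease_costs[OF assms(1) t]] assms(2) eq by simp
  then show "ereal t \<le> ereal A"
    using assms(3)[OF _ t] by (meson ereal_less_eq(3) linorder_not_le)
qed

section \<open>The upper bound by each element tolerance\<close>

lemma reverse_set_lower_tolerance_le_single:
  assumes "cmp_instance I" "E \<subseteq> ground I" "e \<in> E" "admissible I {e} (\<lambda>_. t)"
    and "opt_value (decrease_costs I (\<lambda>_. t) {e}) < opt_value I"
  shows "reverse_set_lower_tolerance I E \<le> ereal t"
proof -
  define \<alpha> where "\<alpha> = (\<lambda>x. if x = e then t else 0)"
  have "finite E"
    using assms(1,2) by (auto simp: cmp_instance_def intro: finite_subset)
  then have "(\<Sum>x\<in>E. \<alpha> x) = t"
    using assms(3) by (simp add: \<alpha>_def)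
  moreover have "admissible I E \<alpha>"
    using assms by (cases "objective_type I")
      (auto simp: \<alpha>_def admissible_def maxdec_def cmp_instance_def)
  moreover have "decrease_costs I \<alpha> E = decrease_costs I (\<lambda>_. t) {e}"
  proof -
    have "(\<lambda>x. if x \<in> E then cost I x - \<alpha> x else cost I x) =
        (\<lambda>x. if x \<in> {e} then cost I x - t else cost I x)"
      using assms(3) by (auto simp: \<alpha>_def)
    then show ?thesis by (simp add: decrease_costs_def)
  qed
  ultimately show ?thesis
    unfolding reverse_set_lower_tolerance_def using assms(5)
    by (intro Inf_lower) auto
qed

lemma objective_decrease_single_product:
  assumes "objective_type I = Product_Objective" "finite S" "e \<in> S"
  shows "objective (decrease_costs I (\<lambda>_. t) {e}) S = (cost I e - t) * (\<Prod>a\<in>S - {e}. cost I a)"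
  using assms by (simp add: objective_def prod.remove[of S e])

lemma prod_cost_pos:
  assumes "cmp_instance I" "objective_type I = Product_Objective" "S \<subseteq> ground I"
  shows "0 < (\<Prod>a\<in>S. cost I a)"
  by (rule prod_pos) (use cmp_instance_cost_pos[OF assms(1,2)] assms(3) in auto)

text \<open>The value of \<open>S\<close> is \<open>cost I e - t\<close> times a constant, so it is
  below the positive optimum already for some \<open>t\<close> bounded away from
  \<open>cost I e\<close>. The strict inequality leaves room for an admissible decrease beyond the
  tolerance.\<close>

lemma lower_tolerance_less_cost:
  assumes I: "cmp_instance I" and type: "objective_type I = Product_Objective"
    and S: "S \<in> feasible I" "e \<in> S"
  shows "lower_tolerance I e < ereal (cost I e)"
proof -
  note SD = cmp_instance_feasibleD[OF I S(1)]
  define P where "P = (\<Prod>a\<in>S - {e}. cost I a)"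
  \<comment> \<open>Halving puts \<open>d\<close> strictly below \<open>opt_value I / P\<close>, the
    remaining cost of \<open>e\<close> at which \<open>S\<close> has exactly the old optimal
    value.\<close>
  define d where "d = min (cost I e) (opt_value I / P) / 2"
  have P: "0 < P"
    unfolding P_def using SD by (intro prod_cost_pos[OF I type]) auto
  have v: "0 < opt_value I"
  proof -
    obtain T where T: "T \<in> feasible I" "objective I T = opt_value I"
      using opt_value_attained[OF I] .
    then show ?thesis
      using prod_cost_pos[OF I type cmp_instance_feasibleD(3)[OF I T(1)]] type
      by (simp add: objective_def)
  qed
  have c: "0 < cost I e"
    using cmp_instance_cost_pos[OF I type] S SD by auto
  have d: "0 < d" "d < opt_value I / P"
    using P v c by (auto simp: d_def min_def divide_simps)
  have "lower_tolerance I e \<le> ereal (cost I e - d)"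
  proof (rule lower_tolerance_leI[OF I S(1)])
    fix t
    assume "cost I e - d < t"
    then have "cost I e - t < opt_value I / P"
      using d by linarith
    then show "objective (decrease_costs I (\<lambda>_. t) {e}) S < opt_value I"
      using P by (simp add: objective_decrease_single_product[OF type SD(1) S(2)] P_def[symmetric]
        pos_less_divide_eq)
  qed
  also have "\<dots> < ereal (cost I e)"
    using d by simp
  finally show ?thesis .
qed

lemma reverse_set_lower_tolerance_le:
  assumes I: "cmp_instance I" and E: "E \<subseteq> ground I" "e \<in> E"
    and cover: "objective_type I = Product_Objective \<Longrightarrow> e \<in> \<Union> (feasible I)"
  shows "reverse_set_lower_tolerance I E \<le> lower_tolerance I e"
proof (rule ccontr)
  assume "\<not> reverse_set_lower_tolerance I E \<le> lower_tolerance I e"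
  then have less: "lower_tolerance I e < reverse_set_lower_tolerance I E"
    by simp
  \<comment> \<open>For sum and bottleneck this only says that the tolerance is not infinite, which
    \<open>less\<close> gives. Hence some \<open>u\<close> beyond the tolerance is both admissible
    and below the reverse tolerance.\<close>
  have "lower_tolerance I e < maxdec I e"
    using less lower_tolerance_less_cost[OF I] cover
    by (cases "objective_type I") (auto simp: maxdec_def less_top[symmetric])
  then obtain u where u: "lower_tolerance I e < u" "u < reverse_set_lower_tolerance I E"
      "u < maxdec I e"
    using less dense[of "lower_tolerance I e" "min (reverse_set_lower_tolerance I E) (maxdec I e)"]
    by auto
  moreover have "0 \<le> lower_tolerance I e"
    using lower_tolerance_nonneg[OF I] E by auto
  ultimately obtain t where t: "u = ereal t" "0 \<le> t"
    by (cases u) (auto simp: zero_ereal_def dest: order.strict_trans1)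
  then have adm: "admissible I {e} (\<lambda>_. t)"
    using u by (simp add: admissible_def)
  from reverse_set_lower_tolerance_le_single[OF I E adm
      opt_value_less_if_lower_tolerance_less[OF I adm]] u t
  show False by simp
qed

section \<open>Concentrating a decrease on one element\<close>

lemma Weierstrass_prod_ge:
  fixes x :: "'a \<Rightarrow> real"
  assumes "finite A" "\<And>a. a \<in> A \<Longrightarrow> 0 \<le> x a \<and> x a \<le> 1"
  shows "1 - (\<Sum>a\<in>A. x a) \<le> (\<Prod>a\<in>A. 1 - x a)"
  using assms
proof (induction A rule: finite_induct)
  case empty
  then show ?case by simp
next
  case (insert b A)
  have "(1 - x b) * (1 - (\<Sum>a\<in>A. x a)) \<le> (1 - x b) * (\<Prod>a\<in>A. 1 - x a)"
    using insert by (intro mult_left_mono) auto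
  \<comment> \<open>This is the cross term left over when the product on the left above is
    expanded.\<close>
  moreover have "0 \<le> x b * (\<Sum>a\<in>A. x a)"
    using insert.prems by (intro mult_nonneg_nonneg sum_nonneg) auto
  ultimately show ?case
    using insert.hyps by (simp add: algebra_simps)
qed

text \<open>After division by the product of all \<open>c b\<close>, the claim follows from the
  Weierstrass inequality for \<open>\<alpha> b / c b\<close>: with \<open>c e\<close> minimal,
  replacing each denominator by \<open>c e\<close> only increases the sum. The left side may be
  negative.\<close>

lemma prod_diff_ge_concentrated:
  fixes c \<alpha> :: "'a \<Rightarrow> real"
  assumes "finite B" "B \<noteq> {}" and \<alpha>: "\<And>b. b \<in> B \<Longrightarrow> 0 \<le> \<alpha> b \<and> \<alpha> b < c b"
  obtains e where "e \<in> B"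
    "(c e - (\<Sum>b\<in>B. \<alpha> b)) * (\<Prod>b\<in>B - {e}. c b) \<le> (\<Prod>b\<in>B. c b - \<alpha> b)"
proof -
  obtain e where e: "e \<in> B" "\<And>b. b \<in> B \<Longrightarrow> c e \<le> c b"
    using arg_min_if_finite[OF assms(1,2), of c] by (meson linorder_not_less)
  have c: "0 < c b" if "b \<in> B" for b
    using \<alpha>[OF that] by linarith
  have "(\<Sum>b\<in>B. \<alpha> b / c b) \<le> (\<Sum>b\<in>B. \<alpha> b / c e)"
    using \<alpha> c e by (intro sum_mono divide_left_mono) auto
  then have "1 - (\<Sum>b\<in>B. \<alpha> b) / c e \<le> 1 - (\<Sum>b\<in>B. \<alpha> b / c b)"
    by (simp add: sum_divide_distrib)
  also have "\<dots> \<le> (\<Prod>b\<in>B. 1 - \<alpha> b / c b)"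
    using \<alpha> c by (intro Weierstrass_prod_ge assms(1)) (auto simp: less_imp_le)
  finally have "(\<Prod>b\<in>B. c b) * (1 - (\<Sum>b\<in>B. \<alpha> b) / c e) \<le>
      (\<Prod>b\<in>B. c b) * (\<Prod>b\<in>B. 1 - \<alpha> b / c b)"
    using c by (intro mult_left_mono prod_nonneg) (auto simp: less_imp_le)
  also have "\<dots> = (\<Prod>b\<in>B. c b - \<alpha> b)"
    unfolding prod.distrib[symmetric]
  proof (rule prod.cong)
    fix b assume "b \<in> B"
    with c[of b] show "c b * (1 - \<alpha> b / c b) = c b - \<alpha> b"
      by (simp add: field_simps)
  qed simp
  also have "(\<Prod>b\<in>B. c b) * (1 - (\<Sum>b\<in>B. \<alpha> b) / c e) =
      (c e - (\<Sum>b\<in>B. \<alpha> b)) * (\<Prod>b\<in>B - {e}. c b)"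
    using c[OF e(1)] by (simp add: prod.remove[OF assms(1) e(1)] field_simps)
  finally show thesis using that e(1) by blast
qed

text \<open>The element \<open>e\<close> is chosen before \<open>t\<close>, so that one
  \<open>e\<close> works for every \<open>t\<close> from the total of \<open>\<alpha>\<close>
  upwards, as \<open>lower_tolerance_leI\<close> requires.\<close>

lemma objective_decrease_single_le:
  assumes I: "cmp_instance I" and E: "E \<subseteq> ground I" and adm: "admissible I E \<alpha>"
    and type: "objective_type I = Sum_Objective \<or> objective_type I = Product_Objective"
    and S: "S \<in> feasible I" "S \<inter> E \<noteq> {}"
  obtains e where "e \<in> S \<inter> E"
    "\<And>t. (\<Sum>x\<in>E. \<alpha> x) \<le> t \<Longrightarrow>
       objective (decrease_costs I (\<lambda>_. t) {e}) S \<le> objective (decrease_costs I \<alpha> E) S"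
proof -
  note SD = cmp_instance_feasibleD[OF I S(1)]
  have fin: "finite E"
    using I E by (auto simp: cmp_instance_def intro: finite_subset)
  have le: "(\<Sum>x\<in>S \<inter> E. \<alpha> x) \<le> (\<Sum>x\<in>E. \<alpha> x)"
    using fin adm by (intro sum_mono2) (auto simp: admissible_def)
  from type show thesis
  proof
    assume sum: "objective_type I = Sum_Objective"
    obtain e where e: "e \<in> S \<inter> E" using S by auto
    \<comment> \<open>A sum depends only on the total amount removed inside \<open>S\<close>, so any
      \<open>e\<close> in \<open>S \<inter> E\<close> will do.\<close>
    have eq: "objective (decrease_costs I \<beta> F) S = (\<Sum>a\<in>S. cost I a) - (\<Sum>a\<in>S \<inter> F. \<beta> a)" for \<beta> F
    proof -
      have "objective (decrease_costs I \<beta> F) S = (\<Sum>a\<in>S. cost I a - (if a \<in> F then \<beta> a else 0))"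
        by (auto simp: objective_def sum intro: sum.cong)
      then show ?thesis
        using SD(1) by (simp add: sum_subtractf sum.inter_restrict)
    qed
    have "S \<inter> {e} = {e}" using e by auto
    then show thesis using that[OF e] le by (simp add: eq)
  next
    assume prod: "objective_type I = Product_Objective"
    have \<alpha>: "0 \<le> \<alpha> b \<and> \<alpha> b < cost I b" if "b \<in> S \<inter> E" for b
      using adm that prod by (auto simp: admissible_def maxdec_def)
    obtain e where e: "e \<in> S \<inter> E"
      "(cost I e - (\<Sum>b\<in>S \<inter> E. \<alpha> b)) * (\<Prod>b\<in>S \<inter> E - {e}. cost I b) \<le>
        (\<Prod>b\<in>S \<inter> E. cost I b - \<alpha> b)"
      using prod_diff_ge_concentrated[OF finite_Int[OF disjI1[OF SD(1)]] S(2) \<alpha>, of "\<lambda>b. b"] by blast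
    have nonneg: "0 \<le> (\<Prod>b\<in>T. cost I b)" if "T \<subseteq> S" for T
      using prod_cost_pos[OF I prod, of T] that SD(3) by (simp add: less_imp_le)
    show thesis
    proof (rule that[OF e(1)])
      fix t
      assume t: "(\<Sum>x\<in>E. \<alpha> x) \<le> t"
      have "objective (decrease_costs I (\<lambda>_. t) {e}) S =
          (cost I e - t) * (\<Prod>b\<in>S - {e}. cost I b)"
        using objective_decrease_single_product[OF prod SD(1)] e(1) by simp
      \<comment> \<open>Only the other factors need a sign here; \<open>cost I e - t\<close> may be
        negative.\<close>
      also have "\<dots> \<le> (cost I e - (\<Sum>b\<in>S \<inter> E. \<alpha> b)) * (\<Prod>b\<in>S - {e}. cost I b)"
        using le t by (intro mult_right_mono nonneg) auto
      also have "(\<Prod>b\<in>S - {e}. cost I b) =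
          (\<Prod>b\<in>S \<inter> E - {e}. cost I b) * (\<Prod>b\<in>S - E. cost I b)"
        using SD(1) e(1) by (subst prod.union_disjoint[symmetric]) (auto intro: prod.cong)
      also have "(cost I e - (\<Sum>b\<in>S \<inter> E. \<alpha> b)) * \<dots> \<le>
          (\<Prod>b\<in>S \<inter> E. cost I b - \<alpha> b) * (\<Prod>b\<in>S - E. cost I b)"
        unfolding mult.assoc[symmetric] by (intro mult_right_mono e(2) nonneg) auto
      also have "\<dots> = objective (decrease_costs I \<alpha> E) S"
        using SD(1) by (simp add: objective_def prod prod.If_cases Diff_eq)
      finally show "objective (decrease_costs I (\<lambda>_. t) {e}) S \<le>
          objective (decrease_costs I \<alpha> E) S" .
    qed
  qed
qed

section \<open>The lower bound for sums and products\<close>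

lemma reverse_set_lower_tolerance_ge:
  assumes I: "cmp_instance I" and E: "E \<subseteq> ground I"
    and type: "objective_type I = Sum_Objective \<or> objective_type I = Product_Objective"
  shows "(INF e\<in>E. lower_tolerance I e) \<le> reverse_set_lower_tolerance I E"
  unfolding reverse_set_lower_tolerance_def
proof (rule Inf_greatest, clarify)
  fix \<alpha>
  assume adm: "admissible I E \<alpha>" and less: "opt_value (decrease_costs I \<alpha> E) < opt_value I"
  obtain S where S: "S \<in> feasible I" "objective (decrease_costs I \<alpha> E) S < opt_value I"
    using opt_value_attained[OF cmp_instance_decrease_costs[OF I adm]] less
    by (metis decrease_costs_simps(2))
  \<comment> \<open>A solution disjoint from \<open>E\<close> keeps its value and so cannot fall
    below the optimum.\<close>
  have "S \<inter> E \<noteq> {}"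
  proof
    assume disj: "S \<inter> E = {}"
    have "objective I S \<le> objective (decrease_costs I \<alpha> E) S"
    proof (rule objective_mono)
      fix a
      assume "a \<in> S"
      then show "cost I a \<le> cost (decrease_costs I \<alpha> E) a"
        using disj by auto
      assume "objective_type (decrease_costs I \<alpha> E) = Product_Objective"
      then show "0 \<le> cost I a"
        using \<open>a \<in> S\<close> cmp_instance_cost_pos[OF I] cmp_instance_feasibleD(3)[OF I S(1)]
        by (simp add: subset_iff less_imp_le)
    qed (use cmp_instance_feasibleD[OF I S(1)] in auto)
    with S opt_value_le_objective[OF I S(1)] show False by simp
  qed
  from objective_decrease_single_le[OF I E adm type S(1) this]
  obtain e where e: "e \<in> S \<inter> E"
    "\<And>t. (\<Sum>x\<in>E. \<alpha> x) \<le> t \<Longrightarrow>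
       objective (decrease_costs I (\<lambda>_. t) {e}) S \<le> objective (decrease_costs I \<alpha> E) S"
    by blast
  have "(INF e\<in>E. lower_tolerance I e) \<le> lower_tolerance I e"
    using e by (intro INF_lower) auto
  \<comment> \<open>Any larger decrease of \<open>e\<close> alone makes \<open>S\<close> at least as
    cheap as \<open>\<alpha>\<close> does, hence cheaper than the old optimum.\<close>
  also have "\<dots> \<le> ereal (\<Sum>x\<in>E. \<alpha> x)"
    by (rule lower_tolerance_leI[OF I S(1)]) (rule order.strict_trans1[OF e(2) S(2)], simp)
  finally show "(INF e\<in>E. lower_tolerance I e) \<le> ereal (\<Sum>x\<in>E. \<alpha> x)" .
qed

text \<open>The covering hypothesis excludes the situation of
  \<open>uncovered_product_element\<close>, where the inequality fails. For empty \<open>E\<close>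
  both sides are infinite.\<close>

theorem theorem6:
  fixes I :: "'a cmp" and E :: "'a set"
  assumes "cmp_instance I"
    and "E \<subseteq> ground I"
    and "objective_type I = Product_Objective \<Longrightarrow> E \<subseteq> \<Union> (feasible I)"
  shows "reverse_set_lower_tolerance I E \<le> (INF e\<in>E. lower_tolerance I e) \<and>
    (objective_type I = Sum_Objective \<or> objective_type I = Product_Objective \<longrightarrow>
       reverse_set_lower_tolerance I E = (INF e\<in>E. lower_tolerance I e))"
proof -
  have "reverse_set_lower_tolerance I E \<le> (INF e\<in>E. lower_tolerance I e)"
    using assms by (intro INF_greatest reverse_set_lower_tolerance_le) auto
  then show ?thesis
    using reverse_set_lower_tolerance_ge[OF assms(1,2)] by (auto intro: antisym)
qed

end
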